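(* Let $(M^{2n+1},\varphi,Q,\xi,\eta,g)$ be a weak almost contact B-metric manifold and let $\nabla$ be the Levi-Civita connection of $g$. If $\varphi$ and $\eta$ are parallel with respect to $\xi$, i.e. $\nabla_\xi\varphi=0$ and $\nabla_\xi\eta=0$, then $Q$ is parallel with respect to $\xi$, i.e. $\nabla_\xi Q=0$.
   Context: $\chi(M)$ denotes the smooth vector fields on $M$. A smooth manifold $M^{2n+1}$ ($n\ge 1$) carries a weak almost contact structure $(\varphi,Q,\xi,\eta)$ if it admits a $(1,1)$-tensor field $\varphi$, a nonsingular $(1,1)$-tensor field $Q$, a vector field $\xi$ and a 1-form $\eta$ such that $\varphi^2=-Q+\eta\otimes\xi$, $\eta(\xi)=1$, $Q\xi=\xi$, and $\mathcal{D}:=\operatorname{Ker}\eta$ (the contact distribution) is $\varphi$-invariant, i.e. $\varphi(\mathcal{D})\subset\mathcal{D}$. Here $(\eta\otimes\xi)(X)=\eta(X)\xi$. If moreover $g$ is a (semi-)Riemannian metric on $M$ (Riemannian or indefinite) with $g(\varphi X,\varphi Y)=-g(X,QY)+\eta(X)\eta(Y)$ for all $X,Y\in\chi(M)$, then $(M^{2n+1},\varphi,Q,\xi,\eta,g)$ is called a weak almost contact B-metric manifold. *)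

theory Defs
  imports "HOL-Analysis.Analysis" "HOL-Library.Function_Algebras"
begin

text \<open>
  Tangent vectors are derivations, hence real-valued functionals on functions. The pointwise
  real vector space structure on functions makes \<open>subspace\<close>, \<open>dim\<close> etc. available for them.
\<close>

instantiation "fun" :: (type, real_vector) real_vector
begin

definition scaleR_fun :: "real \<Rightarrow> ('a \<Rightarrow> 'b) \<Rightarrow> 'a \<Rightarrow> 'b" where
  "scaleR_fun c f = (\<lambda>x. c *\<^sub>R f x)"

instance
  by standard (auto simp: scaleR_fun_def fun_eq_iff scaleR_add_right scaleR_add_left)

end

lemma scaleR_fun_apply [simp]: "(c *\<^sub>R f) x = c *\<^sub>R f x"
  by (simp add: scaleR_fun_def)

definition linear_between :: "'u::real_vector set \<Rightarrow> 'w::real_vector set \<Rightarrow> ('u \<Rightarrow> 'w) \<Rightarrow> bool" where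
  "linear_between S T L \<longleftrightarrow>
     (\<forall>u\<in>S. L u \<in> T) \<and>
     (\<forall>u\<in>S. \<forall>v\<in>S. L (u + v) = L u + L v) \<and>
     (\<forall>c. \<forall>u\<in>S. L (c *\<^sub>R u) = c *\<^sub>R L u)"


subsection \<open>Smooth manifolds\<close>

text \<open>\<open>Ck_on k S f\<close> is meant for open \<open>S\<close>: all partial derivatives up to order \<open>k\<close> exist and are continuous.\<close>

primrec Ck_on :: "nat \<Rightarrow> 'e::euclidean_space set \<Rightarrow> ('e \<Rightarrow> 'b::real_normed_vector) \<Rightarrow> bool" where
  "Ck_on 0 S f \<longleftrightarrow> continuous_on S f"
| "Ck_on (Suc k) S f \<longleftrightarrow>
     (\<forall>x\<in>S. f differentiable (at x)) \<and>
     (\<forall>b\<in>Basis. Ck_on k S (\<lambda>x. frechet_derivative f (at x) b))"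

definition smooth_on :: "'e::euclidean_space set \<Rightarrow> ('e \<Rightarrow> 'b::real_normed_vector) \<Rightarrow> bool" where
  "smooth_on S f \<longleftrightarrow> (\<forall>k. Ck_on k S f)"

text \<open>
  The underlying space of the manifold is the whole type \<open>'a\<close>; its dimension is that of
  the model space \<open>'e\<close>. A chart is a pair of a domain and a coordinate map, whose values
  outside the domain are irrelevant.
\<close>

type_synonym ('a, 'e) chart = "'a set \<times> ('a \<Rightarrow> 'e)"

definition is_chart :: "('a::topological_space, 'e::euclidean_space) chart \<Rightarrow> bool" where
  "is_chart c = (case c of (U, x) \<Rightarrow>
     open U \<and> open (x ` U) \<and> homeomorphism U (x ` U) x (inv_into U x))"

definition smooth_manifold ::
  "('a::{t2_space, second_countable_topology}, 'e::euclidean_space) chart set \<Rightarrow> bool" where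
  "smooth_manifold A \<longleftrightarrow>
     (\<forall>c\<in>A. is_chart c) \<and>
     (\<Union>(U, x)\<in>A. U) = UNIV \<and>
     (\<forall>(U, x)\<in>A. \<forall>(V, y)\<in>A. smooth_on (x ` (U \<inter> V)) (y \<circ> inv_into U x))"

definition smooth_functions ::
  "('a::topological_space, 'e::euclidean_space) chart set \<Rightarrow> ('a \<Rightarrow> real) set" where
  "smooth_functions A = {f. \<forall>(U, x)\<in>A. smooth_on (x ` U) (f \<circ> inv_into U x)}"


subsection \<open>Tangent vectors, vector fields and tensor fields\<close>

type_synonym 'a tvec = "('a \<Rightarrow> real) \<Rightarrow> real"
type_synonym 'a vfield = "'a \<Rightarrow> 'a tvec"

text \<open>
  Derivations at \<open>p\<close> of the algebra of smooth functions. The last condition only fixes the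
  value on functions outside this algebra, so that equality of tangent vectors is equality in HOL.
\<close>

definition tangent_space ::
  "('a::topological_space, 'e::euclidean_space) chart set \<Rightarrow> 'a \<Rightarrow> 'a tvec set" where
  "tangent_space A p = {v.
     linear_between (smooth_functions A) UNIV v \<and>
     (\<forall>f\<in>smooth_functions A. \<forall>h\<in>smooth_functions A. v (f * h) = f p * v h + h p * v f) \<and>
     (\<forall>f. f \<notin> smooth_functions A \<longrightarrow> v f = 0)}"

definition vector_fields ::
  "('a::topological_space, 'e::euclidean_space) chart set \<Rightarrow> 'a vfield set" where
  "vector_fields A = {X.
     (\<forall>p. X p \<in> tangent_space A p) \<and>
     (\<forall>f\<in>smooth_functions A. (\<lambda>p. X p f) \<in> smooth_functions A)}"

definition tensor_field_11 ::
  "('a::topological_space, 'e::euclidean_space) chart set \<Rightarrow> ('a \<Rightarrow> 'a tvec \<Rightarrow> 'a tvec) \<Rightarrow> bool" where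
  "tensor_field_11 A T \<longleftrightarrow>
     (\<forall>p. linear_between (tangent_space A p) (tangent_space A p) (T p)) \<and>
     (\<forall>X\<in>vector_fields A. (\<lambda>p. T p (X p)) \<in> vector_fields A)"

definition one_form ::
  "('a::topological_space, 'e::euclidean_space) chart set \<Rightarrow> ('a \<Rightarrow> 'a tvec \<Rightarrow> real) \<Rightarrow> bool" where
  "one_form A \<omega> \<longleftrightarrow>
     (\<forall>p. linear_between (tangent_space A p) UNIV (\<omega> p)) \<and>
     (\<forall>X\<in>vector_fields A. (\<lambda>p. \<omega> p (X p)) \<in> smooth_functions A)"

definition nonsingular_11 ::
  "('a::topological_space, 'e::euclidean_space) chart set \<Rightarrow> ('a \<Rightarrow> 'a tvec \<Rightarrow> 'a tvec) \<Rightarrow> bool" where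
  "nonsingular_11 A T \<longleftrightarrow> (\<forall>p. bij_betw (T p) (tangent_space A p) (tangent_space A p))"


subsection \<open>Semi-Riemannian metrics and the Levi-Civita connection\<close>

definition metric_index ::
  "('a::topological_space, 'e::euclidean_space) chart set \<Rightarrow> ('a \<Rightarrow> 'a tvec \<Rightarrow> 'a tvec \<Rightarrow> real) \<Rightarrow> 'a \<Rightarrow> nat" where
  "metric_index A g p =
     Max {dim S | S. subspace S \<and> S \<subseteq> tangent_space A p \<and> (\<forall>v\<in>S. v \<noteq> 0 \<longrightarrow> g p v v < 0)}"

text \<open>Constancy of the index is automatic on connected manifolds; index 0 is the Riemannian case.\<close>

definition semi_riemannian_metric ::
  "('a::topological_space, 'e::euclidean_space) chart set \<Rightarrow> ('a \<Rightarrow> 'a tvec \<Rightarrow> 'a tvec \<Rightarrow> real) \<Rightarrow> bool" where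
  "semi_riemannian_metric A g \<longleftrightarrow>
     (\<forall>p. \<forall>v\<in>tangent_space A p. linear_between (tangent_space A p) UNIV (g p v)) \<and>
     (\<forall>p. \<forall>v\<in>tangent_space A p. \<forall>w\<in>tangent_space A p. g p v w = g p w v) \<and>
     (\<forall>p. \<forall>v\<in>tangent_space A p. (\<forall>w\<in>tangent_space A p. g p v w = 0) \<longrightarrow> v = 0) \<and>
     (\<forall>X\<in>vector_fields A. \<forall>Y\<in>vector_fields A. (\<lambda>p. g p (X p) (Y p)) \<in> smooth_functions A) \<and>
     (\<exists>k. \<forall>p. metric_index A g p = k)"

text \<open>Vanishes on non-smooth functions, since there \<open>\<lambda>q. Y q f\<close> and \<open>\<lambda>q. X q f\<close> are zero.\<close>

definition lie_bracket :: "'a vfield \<Rightarrow> 'a vfield \<Rightarrow> 'a vfield" where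
  "lie_bracket X Y = (\<lambda>p f. X p (\<lambda>q. Y q f) - Y p (\<lambda>q. X q f))"

definition affine_connection ::
  "('a::topological_space, 'e::euclidean_space) chart set \<Rightarrow> ('a vfield \<Rightarrow> 'a vfield \<Rightarrow> 'a vfield) \<Rightarrow> bool" where
  "affine_connection A nabla \<longleftrightarrow>
     (\<forall>X\<in>vector_fields A. linear_between (vector_fields A) (vector_fields A) (nabla X)) \<and>
     (\<forall>X\<in>vector_fields A. \<forall>Y\<in>vector_fields A. \<forall>Z\<in>vector_fields A.
        nabla (X + Y) Z = nabla X Z + nabla Y Z) \<and>
     (\<forall>f\<in>smooth_functions A. \<forall>X\<in>vector_fields A. \<forall>Y\<in>vector_fields A.
        nabla (\<lambda>p. f p *\<^sub>R X p) Y = (\<lambda>p. f p *\<^sub>R nabla X Y p)) \<and>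
     (\<forall>f\<in>smooth_functions A. \<forall>X\<in>vector_fields A. \<forall>Y\<in>vector_fields A.
        nabla X (\<lambda>p. f p *\<^sub>R Y p) = (\<lambda>p. f p *\<^sub>R nabla X Y p + X p f *\<^sub>R Y p))"

definition levi_civita_connection ::
  "('a::topological_space, 'e::euclidean_space) chart set \<Rightarrow> ('a \<Rightarrow> 'a tvec \<Rightarrow> 'a tvec \<Rightarrow> real) \<Rightarrow>
   ('a vfield \<Rightarrow> 'a vfield \<Rightarrow> 'a vfield) \<Rightarrow> bool" where
  "levi_civita_connection A g nabla \<longleftrightarrow>
     affine_connection A nabla \<and>
     (\<forall>X\<in>vector_fields A. \<forall>Y\<in>vector_fields A. nabla X Y - nabla Y X = lie_bracket X Y) \<and>
     (\<forall>X\<in>vector_fields A. \<forall>Y\<in>vector_fields A. \<forall>Z\<in>vector_fields A. \<forall>p.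
        Z p (\<lambda>q. g q (X q) (Y q)) = g p (nabla Z X p) (Y p) + g p (X p) (nabla Z Y p))"

definition cov_deriv_11 ::
  "('a vfield \<Rightarrow> 'a vfield \<Rightarrow> 'a vfield) \<Rightarrow> 'a vfield \<Rightarrow> ('a \<Rightarrow> 'a tvec \<Rightarrow> 'a tvec) \<Rightarrow> 'a vfield \<Rightarrow> 'a vfield" where
  "cov_deriv_11 nabla X T Y = nabla X (\<lambda>p. T p (Y p)) - (\<lambda>p. T p (nabla X Y p))"

definition cov_deriv_form ::
  "('a vfield \<Rightarrow> 'a vfield \<Rightarrow> 'a vfield) \<Rightarrow> 'a vfield \<Rightarrow> ('a \<Rightarrow> 'a tvec \<Rightarrow> real) \<Rightarrow> 'a vfield \<Rightarrow> 'a \<Rightarrow> real" where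
  "cov_deriv_form nabla X \<omega> Y = (\<lambda>p. X p (\<lambda>q. \<omega> q (Y q))) - (\<lambda>p. \<omega> p (nabla X Y p))"


subsection \<open>Weak almost contact B-metric structures\<close>

definition weak_almost_contact_structure ::
  "('a::topological_space, 'e::euclidean_space) chart set \<Rightarrow> ('a \<Rightarrow> 'a tvec \<Rightarrow> 'a tvec) \<Rightarrow>
   ('a \<Rightarrow> 'a tvec \<Rightarrow> 'a tvec) \<Rightarrow> 'a vfield \<Rightarrow> ('a \<Rightarrow> 'a tvec \<Rightarrow> real) \<Rightarrow> bool" where
  "weak_almost_contact_structure A \<phi> Q \<xi> \<eta> \<longleftrightarrow>
     tensor_field_11 A \<phi> \<and> tensor_field_11 A Q \<and> nonsingular_11 A Q \<and>
     \<xi> \<in> vector_fields A \<and> one_form A \<eta> \<and>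
     (\<forall>p. \<forall>v\<in>tangent_space A p. \<phi> p (\<phi> p v) = - Q p v + \<eta> p v *\<^sub>R \<xi> p) \<and>
     (\<forall>p. \<eta> p (\<xi> p) = 1) \<and>
     (\<forall>p. Q p (\<xi> p) = \<xi> p) \<and>
     (\<forall>p. \<forall>v\<in>tangent_space A p. \<eta> p v = 0 \<longrightarrow> \<eta> p (\<phi> p v) = 0)"

definition weak_almost_contact_B_metric_manifold ::
  "nat \<Rightarrow> ('a::{t2_space, second_countable_topology}, 'e::euclidean_space) chart set \<Rightarrow>
   ('a \<Rightarrow> 'a tvec \<Rightarrow> 'a tvec) \<Rightarrow> ('a \<Rightarrow> 'a tvec \<Rightarrow> 'a tvec) \<Rightarrow> 'a vfield \<Rightarrow>
   ('a \<Rightarrow> 'a tvec \<Rightarrow> real) \<Rightarrow> ('a \<Rightarrow> 'a tvec \<Rightarrow> 'a tvec \<Rightarrow> real) \<Rightarrow> bool" where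
  "weak_almost_contact_B_metric_manifold n A \<phi> Q \<xi> \<eta> g \<longleftrightarrow>
     n \<ge> 1 \<and> DIM('e) = 2 * n + 1 \<and> smooth_manifold A \<and>
     weak_almost_contact_structure A \<phi> Q \<xi> \<eta> \<and>
     semi_riemannian_metric A g \<and>
     (\<forall>X\<in>vector_fields A. \<forall>Y\<in>vector_fields A. \<forall>p.
        g p (\<phi> p (X p)) (\<phi> p (Y p)) = - g p (X p) (Q p (Y p)) + \<eta> p (X p) * \<eta> p (Y p))"

end

theory Submission
  imports Defs
begin

text \<open>
  Write \<open>D\<close> for \<open>\<nabla>\<^sub>\<xi>\<close>. The defining identity \<open>Q = - \<phi>\<^sup>2 + \<eta> \<otimes> \<xi>\<close> expresses \<open>Q\<close> through \<open>\<phi>\<close>, \<open>\<eta>\<close>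
  and \<open>\<xi>\<close>. Differentiating it and inserting \<open>D \<phi> = 0\<close> and \<open>D \<eta> = 0\<close> leaves
  \<open>(D Q) Y = \<eta>(Y) D \<xi>\<close>, so the claim amounts to \<open>D \<xi> = 0\<close>.

  The algebra of the structure forces \<open>\<phi> \<xi> = 0\<close> (\<open>phi_xi_eq_zero\<close>). Hence
  \<open>\<phi> (D \<xi>) = D (\<phi> \<xi>) = 0\<close>, while \<open>\<eta> (D \<xi>) = \<xi> (\<eta> \<xi>) = \<xi> 1 = 0\<close>. By the defining identity
  \<open>Q (D \<xi>) = 0\<close>, and \<open>D \<xi> = 0\<close> because \<open>Q\<close> is nonsingular (\<open>nabla_xi_xi_eq_zero\<close>).
\<close>

lemma linear_between_zero:
  assumes "linear_between S T L" and "u \<in> S"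
  shows "L 0 = 0"
proof -
  have "L (0 *\<^sub>R u) = 0 *\<^sub>R L u"
    using assms unfolding linear_between_def by blast
  then show ?thesis by simp
qed

lemma tangent_space_scaleR:
  assumes "v \<in> tangent_space A p"
  shows "c *\<^sub>R v \<in> tangent_space A p"
  using assms unfolding tangent_space_def linear_between_def
  by (simp add: algebra_simps)

lemma tangent_space_zero:
  assumes "v \<in> tangent_space A p"
  shows "0 \<in> tangent_space A p"
  using tangent_space_scaleR[OF assms, of 0] by simp

text \<open>
  The product rule gives \<open>v 1 = 2 v 1\<close> if \<open>1\<close> is a smooth function; otherwise \<open>v 1 = 0\<close> by the convention
  on the values of tangent vectors outside the smooth functions.
\<close>

lemma tangent_vector_one:
  assumes "v \<in> tangent_space A p"
  shows "v (\<lambda>q. 1) = 0"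
proof (cases "(\<lambda>q. 1) \<in> smooth_functions A")
  case True
  have "v ((\<lambda>q. 1) * (\<lambda>q. 1)) = 1 * v (\<lambda>q. 1) + 1 * v (\<lambda>q. 1)"
    using assms True unfolding tangent_space_def by blast
  then show ?thesis by (simp add: times_fun_def)
next
  case False
  then show ?thesis using assms unfolding tangent_space_def by blast
qed

text \<open>
  Put \<open>t = \<phi> \<xi>\<close>. Then \<open>\<phi> t = \<phi>\<^sup>2 \<xi> = 0\<close>, and the structure identity at \<open>t\<close> gives
  \<open>Q t = \<eta>(t) \<xi> = Q (\<eta>(t) \<xi>)\<close>, so \<open>t = \<eta>(t) \<xi>\<close>. Applying \<open>\<phi>\<close> once more, \<open>0 = \<phi> t = \<eta>(t) t\<close>, and
  either vanishing factor gives \<open>t = 0\<close>.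
\<close>

lemma phi_xi_eq_zero:
  assumes W: "weak_almost_contact_structure A \<phi> Q \<xi> \<eta>"
  shows "\<phi> p (\<xi> p) = 0"
proof -
  define t where "t = \<phi> p (\<xi> p)"
  have xi: "\<xi> p \<in> tangent_space A p"
    using W unfolding weak_almost_contact_structure_def vector_fields_def by blast
  have lin: "linear_between (tangent_space A p) (tangent_space A p) (\<phi> p)"
    "linear_between (tangent_space A p) (tangent_space A p) (Q p)"
    using W unfolding weak_almost_contact_structure_def tensor_field_11_def by blast+
  have inj: "inj_on (Q p) (tangent_space A p)"
    using W unfolding weak_almost_contact_structure_def nonsingular_11_def bij_betw_def by blast
  have square: "\<phi> p (\<phi> p v) = - Q p v + \<eta> p v *\<^sub>R \<xi> p" if "v \<in> tangent_space A p" for v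
    using W that unfolding weak_almost_contact_structure_def by blast
  have eta_xi: "\<eta> p (\<xi> p) = 1" and Q_xi: "Q p (\<xi> p) = \<xi> p"
    using W unfolding weak_almost_contact_structure_def by blast+
  have t: "t \<in> tangent_space A p"
    using lin(1) xi unfolding t_def linear_between_def by blast
  have phi_t: "\<phi> p t = 0"
    using square[OF xi] eta_xi Q_xi unfolding t_def by simp
  have "Q p t = \<eta> p t *\<^sub>R \<xi> p"
    using square[OF t] phi_t linear_between_zero[OF lin(1) xi] by (simp add: eq_neg_iff_add_eq_0)
  also have "\<dots> = Q p (\<eta> p t *\<^sub>R \<xi> p)"
    using lin(2) xi Q_xi unfolding linear_between_def by simp
  finally have t_eq: "t = \<eta> p t *\<^sub>R \<xi> p"
    using inj t tangent_space_scaleR[OF xi] by (auto dest: inj_onD)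
  have "\<phi> p (\<eta> p t *\<^sub>R \<xi> p) = \<eta> p t *\<^sub>R t"
    using lin(1) xi unfolding t_def linear_between_def by blast
  then have "\<eta> p t *\<^sub>R t = 0"
    using t_eq phi_t by simp
  then have "t = 0"
    using t_eq by (metis scaleR_eq_0_iff scaleR_zero_left)
  then show ?thesis unfolding t_def .
qed

text \<open>
  Since \<open>Q\<close> is injective on each tangent space, \<open>\<nabla>\<^sub>\<xi> \<xi>\<close> vanishes as soon as \<open>\<phi>\<close> and \<open>\<eta>\<close> annihilate
  it. Both do, because \<open>\<phi> \<xi>\<close> and \<open>\<eta>(\<xi>)\<close> are constant and the tensors are parallel along \<open>\<xi>\<close>.
\<close>

lemma nabla_xi_xi_eq_zero:
  assumes W: "weak_almost_contact_structure A \<phi> Q \<xi> \<eta>"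
    and C: "affine_connection A nabla"
    and phi_parallel: "cov_deriv_11 nabla \<xi> \<phi> \<xi> = 0"
    and eta_parallel: "cov_deriv_form nabla \<xi> \<eta> \<xi> = 0"
  shows "nabla \<xi> \<xi> = 0"
proof
  fix p
  have xi: "\<xi> \<in> vector_fields A"
    using W unfolding weak_almost_contact_structure_def by blast
  then have xi_p: "\<xi> p \<in> tangent_space A p"
    unfolding vector_fields_def by blast
  have lin: "linear_between (vector_fields A) (vector_fields A) (nabla \<xi>)"
    using C xi unfolding affine_connection_def by blast
  have d: "nabla \<xi> \<xi> p \<in> tangent_space A p"
    using lin xi unfolding linear_between_def vector_fields_def by blast
  have lin_p: "linear_between (tangent_space A p) (tangent_space A p) (\<phi> p)"
    "linear_between (tangent_space A p) (tangent_space A p) (Q p)"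
    using W unfolding weak_almost_contact_structure_def tensor_field_11_def by blast+
  have inj: "inj_on (Q p) (tangent_space A p)"
    using W unfolding weak_almost_contact_structure_def nonsingular_11_def bij_betw_def by blast
  have "(\<lambda>q. \<phi> q (\<xi> q)) = 0"
    using phi_xi_eq_zero[OF W] by (simp add: fun_eq_iff)
  then have "nabla \<xi> (\<lambda>q. \<phi> q (\<xi> q)) = 0"
    using linear_between_zero[OF lin xi] by simp
  then have phi_d: "\<phi> p (nabla \<xi> \<xi> p) = 0"
    using fun_cong[OF phi_parallel, of p] unfolding cov_deriv_11_def by simp
  have "(\<lambda>q. \<eta> q (\<xi> q)) = (\<lambda>q. 1)"
    using W unfolding weak_almost_contact_structure_def by simp
  then have eta_d: "\<eta> p (nabla \<xi> \<xi> p) = 0"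
    using fun_cong[OF eta_parallel, of p] tangent_vector_one[OF xi_p]
    unfolding cov_deriv_form_def by simp
  have "\<phi> p (\<phi> p (nabla \<xi> \<xi> p)) = - Q p (nabla \<xi> \<xi> p) + \<eta> p (nabla \<xi> \<xi> p) *\<^sub>R \<xi> p"
    using W d unfolding weak_almost_contact_structure_def by blast
  then have "Q p (nabla \<xi> \<xi> p) = Q p 0"
    using phi_d eta_d linear_between_zero[OF lin_p(1) xi_p] linear_between_zero[OF lin_p(2) xi_p]
    by simp
  then have "nabla \<xi> \<xi> p = 0"
    using inj d tangent_space_zero[OF xi_p] by (auto dest: inj_onD)
  then show "nabla \<xi> \<xi> p = 0 p" by simp
qed

theorem proposition24:
  fixes n :: nat
    and A :: "('a::{t2_space, second_countable_topology}, 'e::euclidean_space) chart set"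
    and \<phi> Q :: "'a \<Rightarrow> 'a tvec \<Rightarrow> 'a tvec"
    and \<xi> :: "'a vfield"
    and \<eta> :: "'a \<Rightarrow> 'a tvec \<Rightarrow> real"
    and g :: "'a \<Rightarrow> 'a tvec \<Rightarrow> 'a tvec \<Rightarrow> real"
    and nabla :: "'a vfield \<Rightarrow> 'a vfield \<Rightarrow> 'a vfield"
  assumes "weak_almost_contact_B_metric_manifold n A \<phi> Q \<xi> \<eta> g"
    and "levi_civita_connection A g nabla"
    and "\<forall>Y\<in>vector_fields A. cov_deriv_11 nabla \<xi> \<phi> Y = 0"
    and "\<forall>Y\<in>vector_fields A. cov_deriv_form nabla \<xi> \<eta> Y = 0"
  shows "\<forall>Y\<in>vector_fields A. cov_deriv_11 nabla \<xi> Q Y = 0"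
proof
  fix Y assume Y: "Y \<in> vector_fields A"
  have W: "weak_almost_contact_structure A \<phi> Q \<xi> \<eta>"
    using assms(1) unfolding weak_almost_contact_B_metric_manifold_def by blast
  have C: "affine_connection A nabla"
    using assms(2) unfolding levi_civita_connection_def by blast
  have xi: "\<xi> \<in> vector_fields A"
    using W unfolding weak_almost_contact_structure_def by blast
  have lin: "linear_between (vector_fields A) (vector_fields A) (nabla \<xi>)"
    using C xi unfolding affine_connection_def by blast
  have DY: "nabla \<xi> Y \<in> vector_fields A"
    using lin Y unfolding linear_between_def by blast
  have leibniz: "nabla \<xi> (\<lambda>p. f p *\<^sub>R \<xi> p) = (\<lambda>p. f p *\<^sub>R nabla \<xi> \<xi> p + \<xi> p f *\<^sub>R \<xi> p)"
    if "f \<in> smooth_functions A" for f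
    using C xi that unfolding affine_connection_def by blast
  have QY: "(\<lambda>q. Q q (Y q)) \<in> vector_fields A"
    and smooth_etaY: "(\<lambda>q. \<eta> q (Y q)) \<in> smooth_functions A"
    using W Y unfolding weak_almost_contact_structure_def tensor_field_11_def one_form_def by blast+
  have phi_field: "\<forall>Z\<in>vector_fields A. (\<lambda>q. \<phi> q (Z q)) \<in> vector_fields A"
    using W unfolding weak_almost_contact_structure_def tensor_field_11_def by blast
  note phi_Y = bspec[OF phi_field Y]
  note phi_phi_Y = bspec[OF phi_field phi_Y]
  have square: "\<phi> q (\<phi> q (Z q)) = - Q q (Z q) + \<eta> q (Z q) *\<^sub>R \<xi> q"
    if "Z \<in> vector_fields A" for Z q
    using W that unfolding weak_almost_contact_structure_def vector_fields_def by blast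
  have D_phi: "nabla \<xi> (\<lambda>q. \<phi> q (Z q)) = (\<lambda>q. \<phi> q (nabla \<xi> Z q))" if "Z \<in> vector_fields A" for Z
    using assms(3) that unfolding cov_deriv_11_def by (simp add: right_minus_eq)
  have D_eta: "\<xi> p (\<lambda>q. \<eta> q (Y q)) = \<eta> p (nabla \<xi> Y p)" for p
    using fun_cong[OF bspec[OF assms(4) Y], of p] unfolding cov_deriv_form_def by simp
  have D_xi: "nabla \<xi> \<xi> = 0"
    using nabla_xi_xi_eq_zero[OF W C] assms(3,4) xi by blast
  \<comment> \<open>Differentiating \<open>Q Y + \<phi>\<^sup>2 Y = \<eta>(Y) \<xi>\<close>; on the right the product rule applies and \<open>D \<xi> = 0\<close>.\<close>
  have "(\<lambda>q. Q q (Y q)) + (\<lambda>q. \<phi> q (\<phi> q (Y q))) = (\<lambda>q. \<eta> q (Y q) *\<^sub>R \<xi> q)"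
    using square[OF Y] by (simp add: fun_eq_iff)
  then have "nabla \<xi> (\<lambda>q. Q q (Y q)) + nabla \<xi> (\<lambda>q. \<phi> q (\<phi> q (Y q)))
      = nabla \<xi> (\<lambda>q. \<eta> q (Y q) *\<^sub>R \<xi> q)"
    using lin QY phi_phi_Y unfolding linear_between_def by metis
  also have "\<dots> = (\<lambda>p. \<eta> p (Y p) *\<^sub>R nabla \<xi> \<xi> p + \<xi> p (\<lambda>q. \<eta> q (Y q)) *\<^sub>R \<xi> p)"
    using leibniz[OF smooth_etaY] .
  also have "\<dots> = (\<lambda>p. \<eta> p (nabla \<xi> Y p) *\<^sub>R \<xi> p)"
    using D_xi D_eta by simp
  finally have D_Q: "nabla \<xi> (\<lambda>q. Q q (Y q)) + (\<lambda>q. \<phi> q (\<phi> q (nabla \<xi> Y q)))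
      = (\<lambda>p. \<eta> p (nabla \<xi> Y p) *\<^sub>R \<xi> p)"
    using D_phi[OF phi_Y] D_phi[OF Y] by simp
  show "cov_deriv_11 nabla \<xi> Q Y = 0"
  proof
    fix p
    have "nabla \<xi> (\<lambda>q. Q q (Y q)) p + \<phi> p (\<phi> p (nabla \<xi> Y p)) = \<eta> p (nabla \<xi> Y p) *\<^sub>R \<xi> p"
      using fun_cong[OF D_Q, of p] by simp
    then show "cov_deriv_11 nabla \<xi> Q Y p = 0 p"
      using square[OF DY, of p] unfolding cov_deriv_11_def by simp
  qed
qed

end
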